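(* Let $X$ be an abelian group, and let $G$ be any abelian group containing $X$ as a subgroup of index $2$. If $G$ contains a regular partial difference set (respectively, a reversible difference set) $D$, then so does the generalized dihedral extension $\mathcal{G}$ of $X$; that is, $\mathcal{G}$ contains a regular partial difference set (respectively, a reversible difference set).
   Context: All groups are finite. A subset $D$ of a finite group $G$ is a $(v,k,\lambda)$-difference set (DS) if $|G|=v$, $|D|=k$, and every $g\in G\setminus\{1\}$ can be expressed in exactly $\lambda$ ways as $d_1d_2^{-1}$ with $d_1,d_2\in D$. A subset $D$ of $G$ is a $(v,k,\lambda,\mu)$-partial difference set (PDS) if $|G|=v$, $|D|=k$, every nonidentity $g\in D$ can be expressed as $d_1d_2^{-1}$ with $d_1,d_2\in D$ in exactly $\lambda$ ways, and every $g\in G\setminus(D\cup\{1\})$ can be so expressed in exactly $\mu$ ways. A PDS $D$ is regular if $1\notin D$ and $D=\{d^{-1}:d\in D\}$. A DS $D$ is reversible if $D=\{d^{-1}:d\in D\}$. The generalized dihedral extension of an abelian group $X$ is the group $\langle X,g\rangle$ containing $X$ as a subgroup of index $2$, with $g^2=1$ and $gxg=x^{-1}$ for all $x\in X$. *)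

theory Defs
  imports "HOL-Algebra.Algebra"
begin

definition quotient_reps :: "('a, 'm) monoid_scheme \<Rightarrow> 'a set \<Rightarrow> 'a \<Rightarrow> ('a \<times> 'a) set" where
  "quotient_reps G D g = {(d1, d2) \<in> D \<times> D. d1 \<otimes>\<^bsub>G\<^esub> inv\<^bsub>G\<^esub> d2 = g}"

definition difference_set :: "('a, 'm) monoid_scheme \<Rightarrow> 'a set \<Rightarrow> nat \<Rightarrow> nat \<Rightarrow> nat \<Rightarrow> bool" where
  "difference_set G D v k l \<longleftrightarrow>
     D \<subseteq> carrier G \<and> order G = v \<and> card D = k \<and>
     (\<forall>g \<in> carrier G - {\<one>\<^bsub>G\<^esub>}. card (quotient_reps G D g) = l)"

definition partial_difference_set ::
    "('a, 'm) monoid_scheme \<Rightarrow> 'a set \<Rightarrow> nat \<Rightarrow> nat \<Rightarrow> nat \<Rightarrow> nat \<Rightarrow> bool" where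
  "partial_difference_set G D v k l m \<longleftrightarrow>
     D \<subseteq> carrier G \<and> order G = v \<and> card D = k \<and>
     (\<forall>g \<in> D - {\<one>\<^bsub>G\<^esub>}. card (quotient_reps G D g) = l) \<and>
     (\<forall>g \<in> carrier G - (D \<union> {\<one>\<^bsub>G\<^esub>}). card (quotient_reps G D g) = m)"

definition regular_pds ::
    "('a, 'm) monoid_scheme \<Rightarrow> 'a set \<Rightarrow> nat \<Rightarrow> nat \<Rightarrow> nat \<Rightarrow> nat \<Rightarrow> bool" where
  "regular_pds G D v k l m \<longleftrightarrow>
     partial_difference_set G D v k l m \<and> \<one>\<^bsub>G\<^esub> \<notin> D \<and> D = {inv\<^bsub>G\<^esub> d |d. d \<in> D}"

definition reversible_ds :: "('a, 'm) monoid_scheme \<Rightarrow> 'a set \<Rightarrow> nat \<Rightarrow> nat \<Rightarrow> nat \<Rightarrow> bool" where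
  "reversible_ds G D v k l \<longleftrightarrow>
     difference_set G D v k l \<and> D = {inv\<^bsub>G\<^esub> d |d. d \<in> D}"

text \<open>Containment of a group \<open>A\<close> in a group \<open>G\<close> is expressed by an injective homomorphism
  \<open>i\<close>, so that different overgroups of \<open>A\<close> may live on different types.\<close>

definition index_two_embedding ::
    "('x \<Rightarrow> 'a) \<Rightarrow> ('x, 'n) monoid_scheme \<Rightarrow> ('a, 'm) monoid_scheme \<Rightarrow> bool" where
  "index_two_embedding i A G \<longleftrightarrow>
     i \<in> mon A G \<and> card (rcosets\<^bsub>G\<^esub> (i ` carrier A)) = 2"

definition generalized_dihedral_extension ::
    "('x \<Rightarrow> 'a) \<Rightarrow> ('x, 'n) monoid_scheme \<Rightarrow> ('a, 'm) monoid_scheme \<Rightarrow> bool" where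
  "generalized_dihedral_extension i A G \<longleftrightarrow>
     group G \<and> index_two_embedding i A G \<and>
     (\<exists>g \<in> carrier G.
        generate G (insert g (i ` carrier A)) = carrier G \<and>
        g \<otimes>\<^bsub>G\<^esub> g = \<one>\<^bsub>G\<^esub> \<and>
        (\<forall>x \<in> carrier A. g \<otimes>\<^bsub>G\<^esub> i x \<otimes>\<^bsub>G\<^esub> g = inv\<^bsub>G\<^esub> (i x)))"

end

theory Submission
  imports Defs
begin

text \<open>
  Choose \<open>t \<in> G\<close> outside \<open>X\<close>, so that \<open>G = X \<union> t X\<close> and \<open>\<G> = X \<union> g X\<close> for the inverting
  involution \<open>g\<close>. The bijection \<open>\<phi>\<close> with \<open>x \<mapsto> x\<close> and \<open>t x \<mapsto> g x\<close> is not a homomorphism, but it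
  satisfies

    \<open>\<phi> d \<phi> w = \<phi> (d w)\<close> if \<open>w \<in> X\<close>, and \<open>\<phi> d \<phi> w = \<phi> (d\<^sup>-\<^sup>1 w)\<close> if \<open>w \<notin> X\<close>,

  for all \<open>d \<in> G\<close> (\<open>twisted_iso_of_index_two\<close>): the second rule holds because \<open>G\<close> is commutative
  and moving an element of \<open>X\<close> past \<open>g\<close> inverts it.

  If \<open>D = D\<^sup>-\<^sup>1\<close>, then the number of ways to write \<open>w\<close> as a quotient of elements of \<open>D\<close> is the
  number of \<open>d \<in> D\<close> with \<open>d w \<in> D\<close>, and replacing \<open>d\<close> by \<open>d\<^sup>-\<^sup>1\<close> in this condition does not change
  the number. Hence the twist is invisible to inverse-closed sets: \<open>\<phi>\<close> carries \<open>D\<close> to an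
  inverse-closed set, and \<open>\<phi> w\<close> has as many representations over \<open>\<phi> D\<close> as \<open>w\<close> has over \<open>D\<close>
  (\<open>card_quotient_reps_image\<close>). So \<open>\<phi> D\<close> is a set of the required kind, with the same parameters.
\<close>

section \<open>Quotients of inverse-closed sets\<close>

definition inverse_closed :: "('a, 'm) monoid_scheme \<Rightarrow> 'a set \<Rightarrow> bool" where
  "inverse_closed G D \<longleftrightarrow> D = {inv\<^bsub>G\<^esub> d |d. d \<in> D}"

lemma inverse_closed_inv:
  "inverse_closed G D \<Longrightarrow> d \<in> D \<Longrightarrow> inv\<^bsub>G\<^esub> d \<in> D"
  unfolding inverse_closed_def by blast

lemma (in group) inverse_closedI:
  assumes "D \<subseteq> carrier G" "\<And>d. d \<in> D \<Longrightarrow> inv d \<in> D"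
  shows "inverse_closed G D"
proof -
  have "d \<in> {inv d |d. d \<in> D}" if "d \<in> D" for d
    using assms that by (metis (mono_tags, lifting) inv_inv mem_Collect_eq subsetD)
  then show ?thesis
    using assms(2) unfolding inverse_closed_def by blast
qed

lemma regular_pds_iff_inverse_closed:
  "regular_pds G D v k l m \<longleftrightarrow>
     partial_difference_set G D v k l m \<and> \<one>\<^bsub>G\<^esub> \<notin> D \<and> inverse_closed G D"
  unfolding regular_pds_def inverse_closed_def by (rule refl)

lemma reversible_ds_iff_inverse_closed:
  "reversible_ds G D v k l \<longleftrightarrow> difference_set G D v k l \<and> inverse_closed G D"
  unfolding reversible_ds_def inverse_closed_def by (rule refl)

text \<open>The representation \<open>w = d\<^sub>1 d\<^sub>2\<^sup>-\<^sup>1\<close> is determined by \<open>d = d\<^sub>1\<^sup>-\<^sup>1\<close>, as \<open>d w = d\<^sub>2\<^sup>-\<^sup>1\<close>. Counting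
  single elements whose translate stays in \<open>D\<close> is what a bijection of groups can be compared with.\<close>

lemma (in group) card_quotient_reps:
  assumes D: "D \<subseteq> carrier G" "inverse_closed G D" and w: "w \<in> carrier G"
  shows "card (quotient_reps G D w) = card {d \<in> D. d \<otimes> w \<in> D}"
proof (rule bij_betw_same_card, rule bij_betw_byWitness)
  let ?f = "\<lambda>p. inv (fst p)" and ?f' = "\<lambda>d. (inv d, inv (d \<otimes> w))"
  have cancel: "inv d1 \<otimes> w = inv d2"
    if "d1 \<in> D" "d2 \<in> D" "d1 \<otimes> inv d2 = w" for d1 d2
    using that D(1) by (metis inv_closed inv_solve_left m_closed subsetD)
  show "\<forall>p \<in> quotient_reps G D w. ?f' (?f p) = p"
    using cancel D(1) by (auto simp: quotient_reps_def)
  show "\<forall>d \<in> {d \<in> D. d \<otimes> w \<in> D}. ?f (?f' d) = d"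
    using D(1) by auto
  show "?f ` quotient_reps G D w \<subseteq> {d \<in> D. d \<otimes> w \<in> D}"
    using cancel inverse_closed_inv[OF D(2)] by (auto simp: quotient_reps_def)
  have "inv d \<otimes> (d \<otimes> w) = w" if "d \<in> D" for d
    using that D(1) w by (metis inv_closed l_inv l_one m_assoc subsetD)
  then show "?f' ` {d \<in> D. d \<otimes> w \<in> D} \<subseteq> quotient_reps G D w"
    using inverse_closed_inv[OF D(2)] D(1) w by (auto simp: quotient_reps_def)
qed

section \<open>Bijections that respect multiplication up to inversion\<close>

text \<open>Whether the left factor is inverted may depend on the right factor \<open>w\<close> only; this is what
  makes the twist harmless when \<open>w\<close> is fixed and the left factor runs through an inverse-closed set.\<close>

definition twisted_iso ::
    "('a \<Rightarrow> 'b) \<Rightarrow> ('a, 'm) monoid_scheme \<Rightarrow> ('b, 'k) monoid_scheme \<Rightarrow> bool" where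
  "twisted_iso \<phi> G H \<longleftrightarrow>
     bij_betw \<phi> (carrier G) (carrier H) \<and>
     (\<forall>w \<in> carrier G.
        (\<forall>d \<in> carrier G. \<phi> d \<otimes>\<^bsub>H\<^esub> \<phi> w = \<phi> (d \<otimes>\<^bsub>G\<^esub> w)) \<or>
        (\<forall>d \<in> carrier G. \<phi> d \<otimes>\<^bsub>H\<^esub> \<phi> w = \<phi> (inv\<^bsub>G\<^esub> d \<otimes>\<^bsub>G\<^esub> w)))"

locale twisted_group_iso = G: group G + H: group H
  for G :: "('a, 'm) monoid_scheme" (structure)
    and H :: "('b, 'k) monoid_scheme" (structure) +
  fixes \<phi> :: "'a \<Rightarrow> 'b"
  assumes twisted: "twisted_iso \<phi> G H"
begin

lemma bij: "bij_betw \<phi> (carrier G) (carrier H)"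
  using twisted by (simp add: twisted_iso_def)

lemma image_closed [simp]: "x \<in> carrier G \<Longrightarrow> \<phi> x \<in> carrier H"
  using bij by (meson bij_betwE)

lemma mult_cases:
  assumes "w \<in> carrier G"
  obtains
    (straight) "\<And>d. d \<in> carrier G \<Longrightarrow> \<phi> d \<otimes>\<^bsub>H\<^esub> \<phi> w = \<phi> (d \<otimes>\<^bsub>G\<^esub> w)"
  | (inverted) "\<And>d. d \<in> carrier G \<Longrightarrow> \<phi> d \<otimes>\<^bsub>H\<^esub> \<phi> w = \<phi> (inv\<^bsub>G\<^esub> d \<otimes>\<^bsub>G\<^esub> w)"
  using twisted assms unfolding twisted_iso_def by blast

lemma image_one: "\<phi> \<one>\<^bsub>G\<^esub> = \<one>\<^bsub>H\<^esub>"
proof -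
  \<comment> \<open>Both rules agree when the left factor is the identity.\<close>
  have "\<phi> \<one>\<^bsub>G\<^esub> \<otimes>\<^bsub>H\<^esub> \<phi> \<one>\<^bsub>G\<^esub> = \<phi> \<one>\<^bsub>G\<^esub>"
    using G.one_closed by (rule mult_cases) auto
  then show ?thesis
    by (simp add: H.l_cancel_one')
qed

text \<open>Under the inverting rule \<open>\<phi> w \<phi> w = \<phi> (w\<^sup>-\<^sup>1 w) = 1\<close>, so such a \<open>\<phi> w\<close> is an involution.\<close>

lemma inv_image:
  assumes "w \<in> carrier G"
  shows "inv\<^bsub>H\<^esub> (\<phi> w) = \<phi> (inv\<^bsub>G\<^esub> w) \<or> inv\<^bsub>H\<^esub> (\<phi> w) = \<phi> w"
  using assms
proof (cases rule: mult_cases)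
  case straight
  from straight[of "inv\<^bsub>G\<^esub> w"] have "\<phi> (inv\<^bsub>G\<^esub> w) \<otimes>\<^bsub>H\<^esub> \<phi> w = \<one>\<^bsub>H\<^esub>"
    using assms by (simp add: image_one)
  then show ?thesis
    using assms H.inv_equality by simp
next
  case inverted
  from inverted[of w] have "\<phi> w \<otimes>\<^bsub>H\<^esub> \<phi> w = \<one>\<^bsub>H\<^esub>"
    using assms by (simp add: image_one)
  then show ?thesis
    using assms H.inv_equality by simp
qed

lemma inverse_closed_image:
  assumes "D \<subseteq> carrier G" "inverse_closed G D"
  shows "inverse_closed H (\<phi> ` D)"
proof (rule H.inverse_closedI)
  show "\<phi> ` D \<subseteq> carrier H"
    using assms(1) by auto
  fix y assume "y \<in> \<phi> ` D"
  then obtain d where d: "d \<in> D" "y = \<phi> d"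
    by blast
  then have "inv\<^bsub>H\<^esub> y = \<phi> (inv\<^bsub>G\<^esub> d) \<or> inv\<^bsub>H\<^esub> y = \<phi> d"
    using inv_image[of d] assms(1) by blast
  then show "inv\<^bsub>H\<^esub> y \<in> \<phi> ` D"
    using d(1) inverse_closed_inv[OF assms(2) d(1)] by auto
qed

lemma image_mem_iff:
  assumes "D \<subseteq> carrier G" "x \<in> carrier G"
  shows "\<phi> x \<in> \<phi> ` D \<longleftrightarrow> x \<in> D"
  using bij assms by (meson bij_betw_def inj_on_image_mem_iff)

text \<open>In the inverted case the two sides count \<open>d \<in> D\<close> with \<open>d w \<in> D\<close> and \<open>d\<^sup>-\<^sup>1 w \<in> D\<close>, and
  inversion permutes \<open>D\<close>.\<close>

lemma card_quotient_reps_image: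
  assumes D: "D \<subseteq> carrier G" "inverse_closed G D" and w: "w \<in> carrier G"
  shows "card (quotient_reps H (\<phi> ` D) (\<phi> w)) = card (quotient_reps G D w)"
proof -
  have inj: "inj_on \<phi> S" if "S \<subseteq> D" for S
    using bij that D(1) by (meson bij_betw_def inj_on_subset order_trans)
  have "card (quotient_reps H (\<phi> ` D) (\<phi> w)) = card {y \<in> \<phi> ` D. y \<otimes>\<^bsub>H\<^esub> \<phi> w \<in> \<phi> ` D}"
    using D w by (intro H.card_quotient_reps inverse_closed_image) auto
  also have "{y \<in> \<phi> ` D. y \<otimes>\<^bsub>H\<^esub> \<phi> w \<in> \<phi> ` D} = \<phi> ` {d \<in> D. \<phi> d \<otimes>\<^bsub>H\<^esub> \<phi> w \<in> \<phi> ` D}"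
    by auto
  also have "card \<dots> = card {d \<in> D. \<phi> d \<otimes>\<^bsub>H\<^esub> \<phi> w \<in> \<phi> ` D}"
    by (rule card_image, rule inj) auto
  also have "\<dots> = card {d \<in> D. d \<otimes>\<^bsub>G\<^esub> w \<in> D}"
    using w
  proof (cases rule: mult_cases)
    case straight
    have "\<phi> d \<otimes>\<^bsub>H\<^esub> \<phi> w \<in> \<phi> ` D \<longleftrightarrow> d \<otimes>\<^bsub>G\<^esub> w \<in> D" if "d \<in> D" for d
      using straight[of d] that w D(1) by (auto simp: image_mem_iff subsetD)
    then show ?thesis
      by (metis (no_types, lifting) Collect_cong)
  next
    case inverted
    have "\<phi> d \<otimes>\<^bsub>H\<^esub> \<phi> w \<in> \<phi> ` D \<longleftrightarrow> inv\<^bsub>G\<^esub> d \<otimes>\<^bsub>G\<^esub> w \<in> D" if "d \<in> D" for d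
    proof -
      have "d \<in> carrier G"
        using that D(1) by blast
      then show ?thesis
        using inverted[of d] w D(1) by (simp add: image_mem_iff)
    qed
    then have "{d \<in> D. \<phi> d \<otimes>\<^bsub>H\<^esub> \<phi> w \<in> \<phi> ` D} = {d \<in> D. inv\<^bsub>G\<^esub> d \<otimes>\<^bsub>G\<^esub> w \<in> D}"
      by blast
    moreover have "bij_betw (\<lambda>d. inv\<^bsub>G\<^esub> d) {d \<in> D. inv\<^bsub>G\<^esub> d \<otimes>\<^bsub>G\<^esub> w \<in> D} {d \<in> D. d \<otimes>\<^bsub>G\<^esub> w \<in> D}"
      by (rule bij_betw_byWitness[where f' = "\<lambda>d. inv\<^bsub>G\<^esub> d"])
        (use D(1) inverse_closed_inv[OF D(2)] in \<open>auto simp: subsetD\<close>)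
    ultimately show ?thesis
      by (simp add: bij_betw_same_card)
  qed
  also have "\<dots> = card (quotient_reps G D w)"
    using G.card_quotient_reps[OF D w] by simp
  finally show ?thesis .
qed

lemma order_eq: "order H = order G"
  using bij_betw_same_card[OF bij] by (simp add: order_def)

lemma card_image_eq: "D \<subseteq> carrier G \<Longrightarrow> card (\<phi> ` D) = card D"
  using bij by (meson bij_betw_def card_image inj_on_subset)

lemma ball_image_diff:
  assumes "S \<subseteq> carrier G" "T \<subseteq> carrier G"
  shows "(\<forall>y \<in> \<phi> ` S - \<phi> ` T. P y) \<longleftrightarrow> (\<forall>x \<in> S - T. P (\<phi> x))"
  using assms image_mem_iff[OF assms(2)] by blast

lemma regular_pds_image:
  assumes "regular_pds G D v k l m"
  shows "regular_pds H (\<phi> ` D) v k l m"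
proof -
  have D: "D \<subseteq> carrier G" "inverse_closed G D"
    and one: "\<one>\<^bsub>G\<^esub> \<notin> D"
    and par: "order G = v" "card D = k"
    and l: "\<forall>w \<in> D - {\<one>\<^bsub>G\<^esub>}. card (quotient_reps G D w) = l"
    and m: "\<forall>w \<in> carrier G - (D \<union> {\<one>\<^bsub>G\<^esub>}). card (quotient_reps G D w) = m"
    using assms by (auto simp: regular_pds_iff_inverse_closed partial_difference_set_def)
  have one': "{\<one>\<^bsub>H\<^esub>} = \<phi> ` {\<one>\<^bsub>G\<^esub>}"
    by (simp add: image_one)
  have car: "carrier H = \<phi> ` carrier G"
    using bij by (simp add: bij_betw_def)
  have "\<forall>y \<in> \<phi> ` D - {\<one>\<^bsub>H\<^esub>}. card (quotient_reps H (\<phi> ` D) y) = l"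
    unfolding one' using D l by (subst ball_image_diff) (auto simp: card_quotient_reps_image subsetD)
  moreover
  have "\<forall>y \<in> carrier H - (\<phi> ` D \<union> {\<one>\<^bsub>H\<^esub>}). card (quotient_reps H (\<phi> ` D) y) = m"
    unfolding one' car image_Un[symmetric] using D m
    by (subst ball_image_diff) (auto simp: card_quotient_reps_image)
  moreover have "\<one>\<^bsub>H\<^esub> \<notin> \<phi> ` D"
    using one image_mem_iff[OF D(1) G.one_closed] by (simp add: image_one)
  moreover have "\<phi> ` D \<subseteq> carrier H"
    using D(1) car by blast
  ultimately show ?thesis
    using inverse_closed_image[OF D] par order_eq card_image_eq[OF D(1)]
    unfolding regular_pds_iff_inverse_closed partial_difference_set_def
    by simp
qed

lemma reversible_ds_image:
  assumes "reversible_ds G D v k l"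
  shows "reversible_ds H (\<phi> ` D) v k l"
proof -
  have D: "D \<subseteq> carrier G" "inverse_closed G D"
    and par: "order G = v" "card D = k"
    and l: "\<forall>w \<in> carrier G - {\<one>\<^bsub>G\<^esub>}. card (quotient_reps G D w) = l"
    using assms by (auto simp: reversible_ds_iff_inverse_closed difference_set_def)
  have one': "{\<one>\<^bsub>H\<^esub>} = \<phi> ` {\<one>\<^bsub>G\<^esub>}"
    by (simp add: image_one)
  have car: "carrier H = \<phi> ` carrier G"
    using bij by (simp add: bij_betw_def)
  have "\<forall>y \<in> carrier H - {\<one>\<^bsub>H\<^esub>}. card (quotient_reps H (\<phi> ` D) y) = l"
    unfolding one' car using D l
    by (subst ball_image_diff) (auto simp: card_quotient_reps_image)
  moreover have "\<phi> ` D \<subseteq> carrier H"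
    using D(1) car by blast
  ultimately show ?thesis
    using inverse_closed_image[OF D] par order_eq card_image_eq[OF D(1)]
    unfolding reversible_ds_iff_inverse_closed difference_set_def
    by simp
qed

end

section \<open>Subgroups of index two\<close>

lemma (in group) rcosets_carrier: "rcosets (carrier G) = {carrier G}"
proof -
  have "carrier G #> x = carrier G" if "x \<in> carrier G" for x
    using that coset_join2 subgroup_self by blast
  then show ?thesis
    unfolding RCOSETS_def by auto
qed

lemma (in group) index_two_proper:
  assumes "card (rcosets K) = 2"
  shows "K \<noteq> carrier G"
  using assms by (auto simp: rcosets_carrier)

lemma (in group) index_two_coset_elem:
  assumes K: "subgroup K G" and card: "card (rcosets K) = 2"
    and t: "t \<in> carrier G - K" and z: "z \<in> carrier G - K"
  obtains x where "x \<in> K" "z = t \<otimes> x"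
proof -
  interpret K: subgroup K G by fact
  obtain a b where ab: "rcosets K = {a, b}"
    using card by (meson card_2_iff)
  have other: "K #> inv u \<in> rcosets K \<and> K #> inv u \<noteq> K" if "u \<in> carrier G - K" for u
  proof
    show "K #> inv u \<in> rcosets K"
      using that K.subset by (auto intro: rcosetsI)
    have "inv u \<notin> K"
      using that K.m_inv_closed by (metis DiffD1 DiffD2 inv_inv)
    then show "K #> inv u \<noteq> K"
      using that coset_join1[of K "inv u"] K K.subset by auto
  qed
  have "K \<in> rcosets K"
    using K K.subset coset_mult_one rcosetsI by (metis one_closed)
  \<comment> \<open>Right cosets of the inverses are used so that the representative \<open>t\<close> comes out on the left.\<close>
  then have "K #> inv z = K #> inv t"
    using other[OF t] other[OF z] ab by auto
  moreover have "inv z \<in> K #> inv z"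
    using rcos_self[of "inv z" K] K z by simp
  ultimately obtain x where x: "x \<in> K" "inv z = x \<otimes> inv t"
    unfolding r_coset_def by auto
  have "z = inv (x \<otimes> inv t)"
    using x(2) z by (metis DiffD1 inv_inv)
  then have "z = t \<otimes> inv x"
    using x(1) t by (simp add: inv_mult_group)
  then show thesis
    using that x(1) by blast
qed

text \<open>Identifying \<open>X\<close> with subgroups \<open>K\<close> of \<open>G\<close> and \<open>L\<close> of \<open>H\<close> by means of \<open>\<psi>\<close>, the bijection sends
  \<open>t x\<close> to \<open>g (\<psi> x)\<close>. The element \<open>t\<close> need not have order \<open>2\<close>: the rule for \<open>w = t x\<close> and \<open>d = t y\<close>
  involves \<open>d\<^sup>-\<^sup>1 w = y\<^sup>-\<^sup>1 x\<close>, in which \<open>t\<^sup>2\<close> cancels, and this matches \<open>g y g x = y\<^sup>-\<^sup>1 x\<close>.\<close>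

lemma twisted_iso_of_index_two:
  fixes G :: "('a, 'm) monoid_scheme" and H :: "('b, 'k) monoid_scheme"
  assumes "comm_group G" and "group H"
    and K: "subgroup K G" "card (rcosets\<^bsub>G\<^esub> K) = 2"
    and L: "subgroup L H" "card (rcosets\<^bsub>H\<^esub> L) = 2"
    and bij: "bij_betw \<psi> K L"
    and hom: "\<And>x y. x \<in> K \<Longrightarrow> y \<in> K \<Longrightarrow> \<psi> (x \<otimes>\<^bsub>G\<^esub> y) = \<psi> x \<otimes>\<^bsub>H\<^esub> \<psi> y"
    and t: "t \<in> carrier G - K" and g: "g \<in> carrier H - L"
    and conj: "\<And>y. y \<in> L \<Longrightarrow> g \<otimes>\<^bsub>H\<^esub> y \<otimes>\<^bsub>H\<^esub> g = inv\<^bsub>H\<^esub> y"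
  shows "\<exists>\<phi>. twisted_iso \<phi> G H"
proof -
  interpret G: comm_group G by fact
  interpret H: group H by fact
  interpret K: subgroup K G by fact
  interpret L: subgroup L H by fact
  have tG: "t \<in> carrier G" and gH: "g \<in> carrier H"
    using t g by auto
  have \<psi>L: "\<psi> x \<in> L" if "x \<in> K" for x
    using bij that by (meson bij_betwE)
  have \<psi>H: "\<psi> x \<in> carrier H" if "x \<in> K" for x
    using \<psi>L[OF that] by simp
  have gg: "g \<otimes>\<^bsub>H\<^esub> g = \<one>\<^bsub>H\<^esub>"
    using conj[of "\<one>\<^bsub>H\<^esub>"] gH by simp
  have \<psi>_inv: "inv\<^bsub>H\<^esub> (\<psi> x) = \<psi> (inv\<^bsub>G\<^esub> x)" if x: "x \<in> K" for x
  proof -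
    have "\<psi> \<one>\<^bsub>G\<^esub> = \<one>\<^bsub>H\<^esub>"
      using hom[of "\<one>\<^bsub>G\<^esub>" "\<one>\<^bsub>G\<^esub>"] \<psi>H[OF K.one_closed] by (simp add: H.l_cancel_one')
    then have "\<psi> (inv\<^bsub>G\<^esub> x) \<otimes>\<^bsub>H\<^esub> \<psi> x = \<one>\<^bsub>H\<^esub>"
      using x hom[of "inv\<^bsub>G\<^esub> x" x] by simp
    then show ?thesis
      using x \<psi>H by (simp add: H.inv_equality)
  qed
  have move: "\<psi> y \<otimes>\<^bsub>H\<^esub> g = g \<otimes>\<^bsub>H\<^esub> \<psi> (inv\<^bsub>G\<^esub> y)" if y: "y \<in> K" for y
  proof -
    have "g \<otimes>\<^bsub>H\<^esub> \<psi> (inv\<^bsub>G\<^esub> y) = g \<otimes>\<^bsub>H\<^esub> (g \<otimes>\<^bsub>H\<^esub> \<psi> y \<otimes>\<^bsub>H\<^esub> g)"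
      using conj[OF \<psi>L[OF y]] \<psi>_inv[OF y] by simp
    also have "\<dots> = (g \<otimes>\<^bsub>H\<^esub> g) \<otimes>\<^bsub>H\<^esub> (\<psi> y \<otimes>\<^bsub>H\<^esub> g)"
      using gH \<psi>H[OF y] by (simp add: H.m_assoc)
    finally show ?thesis
      using gg gH \<psi>H[OF y] by simp
  qed
  have tK: "t \<otimes>\<^bsub>G\<^esub> x \<notin> K" if "x \<in> K" for x
    using that t by (metis DiffD1 DiffD2 G.inv_solve_right K.m_closed K.m_inv_closed K.mem_carrier)
  have gL: "g \<otimes>\<^bsub>H\<^esub> y \<notin> L" if "y \<in> L" for y
    using that g by (metis DiffD1 DiffD2 H.inv_solve_right L.m_closed L.m_inv_closed L.mem_carrier)
  define \<phi> where "\<phi> z = (if z \<in> K then \<psi> z else g \<otimes>\<^bsub>H\<^esub> \<psi> (inv\<^bsub>G\<^esub> t \<otimes>\<^bsub>G\<^esub> z))" for z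
  have \<phi>K: "\<phi> x = \<psi> x" if "x \<in> K" for x
    using that by (simp add: \<phi>_def)
  have \<phi>t: "\<phi> (t \<otimes>\<^bsub>G\<^esub> x) = g \<otimes>\<^bsub>H\<^esub> \<psi> x" if "x \<in> K" for x
  proof -
    have "inv\<^bsub>G\<^esub> t \<otimes>\<^bsub>G\<^esub> (t \<otimes>\<^bsub>G\<^esub> x) = x"
      using that tG by (simp add: G.m_assoc[symmetric])
    then show ?thesis
      using tK[OF that] by (simp add: \<phi>_def)
  qed
  have split: "z \<in> K \<or> (\<exists>x \<in> K. z = t \<otimes>\<^bsub>G\<^esub> x)" if "z \<in> carrier G" for z
    using that G.index_two_coset_elem[OF K t, of z] by blast
  have splitH: "z \<in> L \<or> (\<exists>y \<in> L. z = g \<otimes>\<^bsub>H\<^esub> y)" if "z \<in> carrier H" for z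
    using that H.index_two_coset_elem[OF L g, of z] by blast
  have \<phi>H: "\<phi> z \<in> carrier H" if "z \<in> carrier G" for z
    using split[OF that] \<phi>K \<phi>t \<psi>H gH by auto
  have "inj_on \<phi> (carrier G)"
  proof (rule inj_onI)
    fix a b assume a: "a \<in> carrier G" and b: "b \<in> carrier G" and eq: "\<phi> a = \<phi> b"
    have \<psi>_inj: "x = y" if "x \<in> K" "y \<in> K" "\<psi> x = \<psi> y" for x y
      using bij that by (meson bij_betw_def inj_onD)
    show "a = b"
      using split[OF a] split[OF b]
    proof (elim disjE bexE)
      fix x y assume *: "x \<in> K" "a = t \<otimes>\<^bsub>G\<^esub> x" "y \<in> K" "b = t \<otimes>\<^bsub>G\<^esub> y"
      then have "\<psi> x = \<psi> y"
        using eq gH \<psi>H by (simp add: \<phi>t)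
      then show ?thesis
        using * \<psi>_inj by blast
    next
      assume "a \<in> K" "b \<in> K"
      then show ?thesis
        using eq \<psi>_inj by (simp add: \<phi>K)
    next
      fix y assume "a \<in> K" "y \<in> K" "b = t \<otimes>\<^bsub>G\<^esub> y"
      then show ?thesis
        using eq gL \<psi>L by (metis \<phi>K \<phi>t)
    next
      fix x assume "x \<in> K" "a = t \<otimes>\<^bsub>G\<^esub> x" "b \<in> K"
      then show ?thesis
        using eq gL \<psi>L by (metis \<phi>K \<phi>t)
    qed
  qed
  moreover have "\<phi> ` carrier G = carrier H"
  proof
    show "\<phi> ` carrier G \<subseteq> carrier H"
      using \<phi>H by auto
    have \<psi>_onto: "\<exists>x \<in> K. y = \<psi> x" if "y \<in> L" for y
      using bij that by (auto simp: bij_betw_def)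
    show "carrier H \<subseteq> \<phi> ` carrier G"
    proof
      fix z assume "z \<in> carrier H"
      then consider y where "y \<in> L" "z = y" | y where "y \<in> L" "z = g \<otimes>\<^bsub>H\<^esub> y"
        using splitH by blast
      then show "z \<in> \<phi> ` carrier G"
      proof cases
        case 1
        then show ?thesis
          using \<psi>_onto \<phi>K by (metis K.mem_carrier image_eqI)
      next
        case 2
        then show ?thesis
          using \<psi>_onto \<phi>t tG by (metis G.m_closed K.mem_carrier image_eqI)
      qed
    qed
  qed
  moreover have "\<phi> d \<otimes>\<^bsub>H\<^esub> \<phi> w = \<phi> (d \<otimes>\<^bsub>G\<^esub> w)"
    if w: "w \<in> K" and d: "d \<in> carrier G" for d w
    using split[OF d]
  proof (elim disjE bexE)
    assume "d \<in> K"
    then show ?thesis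
      using w by (simp add: \<phi>K hom)
  next
    fix y assume y: "y \<in> K" "d = t \<otimes>\<^bsub>G\<^esub> y"
    then have "\<phi> (d \<otimes>\<^bsub>G\<^esub> w) = g \<otimes>\<^bsub>H\<^esub> \<psi> (y \<otimes>\<^bsub>G\<^esub> w)"
      using w tG \<phi>t[of "y \<otimes>\<^bsub>G\<^esub> w"] by (simp add: G.m_assoc)
    then show ?thesis
      using y w gH \<psi>H by (simp add: \<phi>K \<phi>t hom H.m_assoc)
  qed
  moreover have "\<phi> d \<otimes>\<^bsub>H\<^esub> \<phi> (t \<otimes>\<^bsub>G\<^esub> x) = \<phi> (inv\<^bsub>G\<^esub> d \<otimes>\<^bsub>G\<^esub> (t \<otimes>\<^bsub>G\<^esub> x))"
    if x: "x \<in> K" and d: "d \<in> carrier G" for d x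
    using split[OF d]
  proof (elim disjE bexE)
    assume y: "d \<in> K"
    have "inv\<^bsub>G\<^esub> d \<otimes>\<^bsub>G\<^esub> (t \<otimes>\<^bsub>G\<^esub> x) = t \<otimes>\<^bsub>G\<^esub> (inv\<^bsub>G\<^esub> d \<otimes>\<^bsub>G\<^esub> x)"
      using y x tG by (simp add: G.m_lcomm)
    moreover have "\<phi> d \<otimes>\<^bsub>H\<^esub> \<phi> (t \<otimes>\<^bsub>G\<^esub> x) = (\<psi> d \<otimes>\<^bsub>H\<^esub> g) \<otimes>\<^bsub>H\<^esub> \<psi> x"
      using y x gH \<psi>H by (simp add: \<phi>K \<phi>t H.m_assoc)
    ultimately show ?thesis
      using y x gH \<psi>H by (simp add: move \<phi>t hom H.m_assoc)
  next
    fix y assume y: "y \<in> K" "d = t \<otimes>\<^bsub>G\<^esub> y"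
    have "inv\<^bsub>G\<^esub> d \<otimes>\<^bsub>G\<^esub> (t \<otimes>\<^bsub>G\<^esub> x) = inv\<^bsub>G\<^esub> y \<otimes>\<^bsub>G\<^esub> (inv\<^bsub>G\<^esub> t \<otimes>\<^bsub>G\<^esub> (t \<otimes>\<^bsub>G\<^esub> x))"
      using y x tG by (simp add: G.inv_mult_group G.m_assoc)
    also have "\<dots> = inv\<^bsub>G\<^esub> y \<otimes>\<^bsub>G\<^esub> x"
      using y x tG by (simp add: G.m_assoc[symmetric, of "inv\<^bsub>G\<^esub> t" t x])
    finally have "inv\<^bsub>G\<^esub> d \<otimes>\<^bsub>G\<^esub> (t \<otimes>\<^bsub>G\<^esub> x) = inv\<^bsub>G\<^esub> y \<otimes>\<^bsub>G\<^esub> x" .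
    moreover have "\<phi> d \<otimes>\<^bsub>H\<^esub> \<phi> (t \<otimes>\<^bsub>G\<^esub> x) = (g \<otimes>\<^bsub>H\<^esub> \<psi> y \<otimes>\<^bsub>H\<^esub> g) \<otimes>\<^bsub>H\<^esub> \<psi> x"
      using y x gH \<psi>H by (simp add: \<phi>t H.m_assoc)
    ultimately show ?thesis
      using y x by (simp add: conj \<psi>L \<psi>_inv \<phi>K hom)
  qed
  ultimately have "twisted_iso \<phi> G H"
    unfolding twisted_iso_def bij_betw_def using split by metis
  then show ?thesis by blast
qed

section \<open>The transfer to the generalized dihedral extension\<close>

lemma mon_image_subgroup:
  assumes "group A" "group G" "i \<in> mon A G"
  shows "subgroup (i ` carrier A) G"
  using assms by (auto simp: mon_def group_hom_def group_hom_axioms_def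
      intro: group_hom.img_is_subgroup)

lemma twisted_iso_generalized_dihedral:
  fixes G :: "('a, 'm) monoid_scheme" and H :: "('b, 'k) monoid_scheme"
  assumes "comm_group A" and G: "comm_group G" and i: "index_two_embedding i A G"
    and j: "generalized_dihedral_extension j A H"
  shows "\<exists>\<phi>. twisted_iso \<phi> G H"
proof -
  interpret A: comm_group A by fact
  interpret G: comm_group G by fact
  interpret H: group H
    using j by (simp add: generalized_dihedral_extension_def)
  let ?K = "i ` carrier A" and ?L = "j ` carrier A"
  let ?\<psi> = "j \<circ> inv_into (carrier A) i"
  have i_mon: "i \<in> mon A G" and K2: "card (rcosets\<^bsub>G\<^esub> ?K) = 2"
    using i by (auto simp: index_two_embedding_def)
  have j_mon: "j \<in> mon A H" and L2: "card (rcosets\<^bsub>H\<^esub> ?L) = 2"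
    using j by (auto simp: index_two_embedding_def generalized_dihedral_extension_def)
  obtain g where g: "g \<in> carrier H" "generate H (insert g ?L) = carrier H"
    and conj: "\<forall>x \<in> carrier A. g \<otimes>\<^bsub>H\<^esub> j x \<otimes>\<^bsub>H\<^esub> g = inv\<^bsub>H\<^esub> (j x)"
    using j by (auto simp: generalized_dihedral_extension_def)
  have K: "subgroup ?K G"
    by (rule mon_image_subgroup[OF A.is_group G.is_group i_mon])
  have L: "subgroup ?L H"
    by (rule mon_image_subgroup[OF A.is_group H.is_group j_mon])
  have i_inj: "inj_on i (carrier A)" and j_inj: "inj_on j (carrier A)"
    using i_mon j_mon by (auto simp: mon_def)
  \<comment> \<open>Otherwise the subgroup \<open>?L\<close> would contain all generators, although it is proper.\<close>
  have "g \<notin> ?L"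
  proof
    assume "g \<in> ?L"
    then have "carrier H \<subseteq> ?L"
      using H.generate_subgroup_incl[OF _ L, of "insert g ?L"] g(2) by simp
    then show False
      using H.index_two_proper[OF L2] subgroup.subset[OF L] by blast
  qed
  moreover obtain t where "t \<in> carrier G - ?K"
    using G.index_two_proper[OF K2] subgroup.subset[OF K] by blast
  moreover have "bij_betw ?\<psi> ?K ?L"
    by (rule bij_betw_trans[OF bij_betw_inv_into[OF inj_on_imp_bij_betw[OF i_inj]]
          inj_on_imp_bij_betw[OF j_inj]])
  moreover have "?\<psi> (x \<otimes>\<^bsub>G\<^esub> y) = ?\<psi> x \<otimes>\<^bsub>H\<^esub> ?\<psi> y" if "x \<in> ?K" "y \<in> ?K" for x y
  proof -
    obtain a where a: "a \<in> carrier A" "x = i a"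
      using \<open>x \<in> ?K\<close> by (rule imageE)
    obtain b where b: "b \<in> carrier A" "y = i b"
      using \<open>y \<in> ?K\<close> by (rule imageE)
    have hom: "i \<in> hom A G" "j \<in> hom A H"
      using i_mon j_mon by (simp_all add: mon_def)
    have "x \<otimes>\<^bsub>G\<^esub> y = i (a \<otimes>\<^bsub>A\<^esub> b)"
      using hom_mult[OF hom(1) a(1) b(1)] a(2) b(2) by simp
    then show ?thesis
      using hom_mult[OF hom(2) a(1) b(1)] a b i_inj by simp
  qed
  ultimately show ?thesis
    using g(1) conj twisted_iso_of_index_two[OF G H.is_group K K2 L L2, of ?\<psi> t g] by blast
qed

theorem theorem3p2:
  fixes A :: "('x, 'n) monoid_scheme"
    and G :: "('a, 'm) monoid_scheme"
    and H :: "('b, 'k) monoid_scheme"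
    and i :: "'x \<Rightarrow> 'a" and j :: "'x \<Rightarrow> 'b"
  assumes "comm_group A" and "finite (carrier A)"
    and "comm_group G" and "finite (carrier G)"
    and "index_two_embedding i A G"
    and "generalized_dihedral_extension j A H" and "finite (carrier H)"
  shows "(\<forall>v k l m. (\<exists>D. regular_pds G D v k l m) \<longrightarrow> (\<exists>D'. regular_pds H D' v k l m)) \<and>
         (\<forall>v k l. (\<exists>D. reversible_ds G D v k l) \<longrightarrow> (\<exists>D'. reversible_ds H D' v k l))"
proof -
  obtain \<phi> where "twisted_iso \<phi> G H"
    using twisted_iso_generalized_dihedral assms(1,3,5,6) by blast
  then interpret twisted_group_iso G H \<phi>
    using assms(3,6)
    by (simp add: twisted_group_iso_def twisted_group_iso_axioms_def comm_group_def
        generalized_dihedral_extension_def)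
  show ?thesis
    using regular_pds_image reversible_ds_image by blast
qed

end
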